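(* Let $n\ge 0$. The number of self-duals $\lambda_{n+2}$ is equal to the number of pairs $(b,d)\in D_n\times D_n$ that satisfy the condition $d\ge b|b^*$. In other words, $$\lambda_{n+2}=\sum_{b\in D_n}re(b|b^*,\top).$$ Furthermore, $$\lambda_{n+2}=\sum_{b\in R_n}\gamma(b)\cdot re(b|b^*,\top),$$ where in the last sum each class $[b]\in R_n$ is identified with its representative $b\in D_n$.
   Context: $B=\{0,1\}$ with $0\le 1$, and $B^n$ carries the componentwise partial order. $D_n$ is the set of monotone functions $B^n\to B$ (monotone Boolean functions of $n$ variables), ordered pointwise. Elements of $D_n$ are represented as bit strings of length $2^n$: $D_0=\{0,1\}$, and $g\in D_n$ with $n>0$ is represented as the concatenation $g_0\cdot g_1$ with $g_0,g_1\in D_{n-1}$, $g_0\le g_1$, where $g_i$ is the restriction of $g$ to last coordinate equal to $i$. The dual $x^*\in D_n$ of $x\in D_n$ is obtained by reversing the string and negating all its bits (equivalently, $x^*(v)=\neg x(\neg v)$ for $v\in B^n$, with $\neg v$ the componentwise negation). An element $x$ is self-dual if $x=x^*$, and $\lambda_n$ is the number of self-dual elements of $D_n$. $x|y$ is bitwise or; $\top=(1\ldots1)$ is the maximal element of $D_n$; $re(x,y)=|\{z\in D_n: x\le z\le y\}|$. Every permutation $\pi\in S_n$ of $\{1,\dots,n\}$ acts on $B^n$ by $\pi(x)=x\circ\pi^{-1}$ (viewing $x$ as a function $\{1,\dots,n\}\to\{0,1\}$) and on $D_n$ by $\pi(g)=g\circ\pi$. For $f,g\in D_n$, $f\sim g$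 if $f=\pi(g)$ for some $\pi\in S_n$. $[f]$ is the equivalence class of $f$, $\gamma(f)=|[f]|$, and $R_n$ is the set of equivalence classes. The representative of a class is its minimal element with respect to the total order on $D_n$ obtained by reading the bit strings as integers. *)

theory Defs
  imports "HOL-Library.FuncSet" "HOL-Combinatorics.Permutations"
begin

text \<open>Points of the cube and functions on it are extensional (\<open>undefined\<close> off their domain), so
  that they are determined by their values on the domain. Since the domains agree, the
  library order \<open>\<le>\<close> and \<open>sup\<close> on function types are the pointwise order and the bitwise or.\<close>

definition cube :: "nat \<Rightarrow> (nat \<Rightarrow> bool) set" where
  "cube n = {1..n} \<rightarrow>\<^sub>E UNIV"

definition mbf :: "nat \<Rightarrow> ((nat \<Rightarrow> bool) \<Rightarrow> bool) set" where
  "mbf n = {g \<in> cube n \<rightarrow>\<^sub>E UNIV. mono_on (cube n) g}"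

definition mbf_top :: "nat \<Rightarrow> (nat \<Rightarrow> bool) \<Rightarrow> bool" where
  "mbf_top n = (\<lambda>v\<in>cube n. True)"

definition neg_point :: "nat \<Rightarrow> (nat \<Rightarrow> bool) \<Rightarrow> nat \<Rightarrow> bool" where
  "neg_point n v = (\<lambda>i\<in>{1..n}. \<not> v i)"

definition dual :: "nat \<Rightarrow> ((nat \<Rightarrow> bool) \<Rightarrow> bool) \<Rightarrow> (nat \<Rightarrow> bool) \<Rightarrow> bool" where
  "dual n x = (\<lambda>v\<in>cube n. \<not> x (neg_point n v))"

definition self_dual_count :: "nat \<Rightarrow> nat" where
  "self_dual_count n = card {x \<in> mbf n. x = dual n x}"

definition re :: "nat \<Rightarrow> ((nat \<Rightarrow> bool) \<Rightarrow> bool) \<Rightarrow> ((nat \<Rightarrow> bool) \<Rightarrow> bool) \<Rightarrow> nat" where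
  "re n x y = card {z \<in> mbf n. x \<le> z \<and> z \<le> y}"

definition perm_point :: "(nat \<Rightarrow> nat) \<Rightarrow> (nat \<Rightarrow> bool) \<Rightarrow> nat \<Rightarrow> bool" where
  "perm_point p x = x \<circ> inv p"

definition perm_fun :: "(nat \<Rightarrow> nat) \<Rightarrow> ((nat \<Rightarrow> bool) \<Rightarrow> bool) \<Rightarrow> (nat \<Rightarrow> bool) \<Rightarrow> bool" where
  "perm_fun p g = g \<circ> perm_point p"

definition mbf_equiv :: "nat \<Rightarrow> (((nat \<Rightarrow> bool) \<Rightarrow> bool) \<times> ((nat \<Rightarrow> bool) \<Rightarrow> bool)) set" where
  "mbf_equiv n = {(f, g). f \<in> mbf n \<and> g \<in> mbf n \<and> (\<exists>p. p permutes {1..n} \<and> f = perm_fun p g)}"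

definition class_size :: "nat \<Rightarrow> ((nat \<Rightarrow> bool) \<Rightarrow> bool) \<Rightarrow> nat" where
  "class_size n f = card (mbf_equiv n `` {f})"

definition mbf_classes :: "nat \<Rightarrow> ((nat \<Rightarrow> bool) \<Rightarrow> bool) set set" where
  "mbf_classes n = mbf n // mbf_equiv n"

definition restrict_last :: "nat \<Rightarrow> bool \<Rightarrow> ((nat \<Rightarrow> bool) \<Rightarrow> bool) \<Rightarrow> (nat \<Rightarrow> bool) \<Rightarrow> bool" where
  "restrict_last n c g = (\<lambda>v\<in>cube n. g (v(Suc n := c)))"

fun bits :: "nat \<Rightarrow> ((nat \<Rightarrow> bool) \<Rightarrow> bool) \<Rightarrow> bool list" where
  "bits 0 g = [g (\<lambda>i. undefined)]"
| "bits (Suc n) g = bits n (restrict_last n False g) @ bits n (restrict_last n True g)"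

text \<open>The leftmost bit of the string is the most significant one, whereas \<open>horner_sum\<close> expects
  the least significant bit first.\<close>

definition bits_value :: "nat \<Rightarrow> ((nat \<Rightarrow> bool) \<Rightarrow> bool) \<Rightarrow> nat" where
  "bits_value n g = horner_sum of_bool 2 (rev (bits n g))"

text \<open>The minimiser is unique because \<open>bits_value n\<close> is injective on \<open>mbf n\<close>; see
  \<open>inj_on_bits_value\<close> below.\<close>

definition representative :: "nat \<Rightarrow> ((nat \<Rightarrow> bool) \<Rightarrow> bool) set \<Rightarrow> (nat \<Rightarrow> bool) \<Rightarrow> bool" where
  "representative n C = arg_min_on (bits_value n) C"

lemma finite_cube: "finite (cube n)"
  by (simp add: cube_def finite_PiE)

lemma finite_mbf: "finite (mbf n)"
  by (simp add: mbf_def finite_PiE finite_cube)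

lemma neg_point_cube: "neg_point n v \<in> cube n"
  by (simp add: neg_point_def cube_def)

lemma cube_undefined: "v \<in> cube n \<Longrightarrow> i \<notin> {1..n} \<Longrightarrow> v i = undefined"
  unfolding cube_def by (rule PiE_arb)

lemma mbf_undefined: "g \<in> mbf n \<Longrightarrow> v \<notin> cube n \<Longrightarrow> g v = undefined"
  by (auto simp: mbf_def intro: PiE_arb)

lemma mbf_le_iff:
  assumes "f \<in> mbf n" "g \<in> mbf n"
  shows "f \<le> g \<longleftrightarrow> (\<forall>v\<in>cube n. f v \<le> g v)"
proof -
  have "f v \<le> g v" if "v \<notin> cube n" for v
    using that assms by (simp add: mbf_undefined)
  then show ?thesis unfolding le_fun_def by blast
qed

lemma sup_mbf: "f \<in> mbf n \<Longrightarrow> g \<in> mbf n \<Longrightarrow> sup f g \<in> mbf n"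
  unfolding mbf_def mono_on_def PiE_def extensional_def by fastforce

lemma mbf_top: "mbf_top n \<in> mbf n"
  by (simp add: mbf_def mbf_top_def mono_on_def)

lemma neg_point_antimono: "v \<le> w \<Longrightarrow> neg_point n w \<le> neg_point n v"
  by (auto simp: neg_point_def le_fun_def)

lemma dual_mbf:
  assumes "x \<in> mbf n" shows "dual n x \<in> mbf n"
proof -
  have mono: "mono_on (cube n) x" using assms by (simp add: mbf_def)
  have "dual n x v \<le> dual n x w" if "v \<in> cube n" "w \<in> cube n" "v \<le> w" for v w
    using mono_onD[OF mono neg_point_cube neg_point_cube neg_point_antimono[OF that(3)]] that(1,2)
    by (auto simp: dual_def)
  then have "mono_on (cube n) (dual n x)" by (rule mono_onI)
  then show ?thesis by (simp add: mbf_def dual_def)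
qed

lemma perm_point_cube:
  assumes "p permutes {1..n}"
  shows "perm_point p v \<in> cube n \<longleftrightarrow> v \<in> cube n"
proof -
  have q: "inv p permutes {1..n}" using assms by (rule permutes_inv)
  then show ?thesis
    unfolding cube_def perm_point_def PiE_def extensional_def
    by (simp add: permutes_not_in[OF q] del: atLeastAtMost_iff)
qed

lemma perm_fun_mbf:
  assumes p: "p permutes {1..n}" and g: "g \<in> mbf n"
  shows "perm_fun p g \<in> mbf n"
proof -
  have "perm_point p v \<le> perm_point p w" if "v \<le> w" for v w
    using that by (auto simp: perm_point_def le_fun_def)
  then have "mono_on (cube n) (perm_fun p g)"
    using g perm_point_cube[OF p] unfolding mbf_def mono_on_def perm_fun_def
    by (metis (mono_tags, lifting) comp_apply mem_Collect_eq)
  moreover have "perm_fun p g \<in> cube n \<rightarrow>\<^sub>E UNIV"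
    using g by (simp add: mbf_def perm_fun_def PiE_def extensional_def perm_point_cube[OF p])
  ultimately show ?thesis by (simp add: mbf_def)
qed

lemma equiv_mbf_equiv: "equiv (mbf n) (mbf_equiv n)"
proof (rule equivI)
  show "mbf_equiv n \<subseteq> mbf n \<times> mbf n" by (auto simp: mbf_equiv_def)
  have "f = perm_fun id f" for f by (simp add: perm_fun_def perm_point_def fun_eq_iff)
  then show "refl_on (mbf n) (mbf_equiv n)"
    by (auto simp: refl_on_def mbf_equiv_def intro: permutes_id)
  show "sym (mbf_equiv n)"
  proof (rule symI)
    fix f g assume "(f, g) \<in> mbf_equiv n"
    then obtain p where p: "p permutes {1..n}" and fg: "f \<in> mbf n" "g \<in> mbf n" "f = perm_fun p g"
      by (auto simp: mbf_equiv_def)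
    have "g = perm_fun (inv p) f"
      unfolding fg(3) perm_fun_def perm_point_def fun_eq_iff
      by (simp add: o_assoc[symmetric] inv_inv_eq[OF permutes_bij[OF p]] permutes_inv_o[OF p])
    then show "(g, f) \<in> mbf_equiv n"
      using fg permutes_inv[OF p] unfolding mbf_equiv_def by blast
  qed
  show "trans (mbf_equiv n)"
  proof (rule transI)
    fix f g h assume "(f, g) \<in> mbf_equiv n" "(g, h) \<in> mbf_equiv n"
    then obtain p q where p: "p permutes {1..n}" and q: "q permutes {1..n}"
      and fh: "f \<in> mbf n" "h \<in> mbf n" "f = perm_fun p (perm_fun q h)"
      by (auto simp: mbf_equiv_def)
    have "f = perm_fun (q \<circ> p) h"
      unfolding fh(3) perm_fun_def perm_point_def fun_eq_iff
      by (simp add: o_assoc o_inv_distrib[OF permutes_bij[OF q] permutes_bij[OF p]])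
    then show "(f, h) \<in> mbf_equiv n"
      using fh permutes_compose[OF p q] unfolding mbf_equiv_def by blast
  qed
qed

lemma length_bits: "length (bits n g) = 2 ^ n"
  by (induction n arbitrary: g) auto

lemma cube_0: "cube 0 = {\<lambda>i. undefined}"
  by (simp add: cube_def)

lemma upd_cube_Suc: "v \<in> cube n \<Longrightarrow> v(Suc n := c) \<in> cube (Suc n)"
  by (auto simp: cube_def PiE_def extensional_def)

lemma cube_SucE:
  assumes "v \<in> cube (Suc n)"
  obtains w where "w \<in> cube n" "v = w(Suc n := v (Suc n))"
proof
  show "v(Suc n := undefined) \<in> cube n"
    using assms by (auto simp: cube_def PiE_def extensional_def)
qed simp

lemma bits_eq_iff: "bits n f = bits n g \<longleftrightarrow> (\<forall>v\<in>cube n. f v = g v)"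
proof (induction n arbitrary: f g)
  case 0
  then show ?case by (simp add: cube_0)
next
  case (Suc n)
  have "bits (Suc n) f = bits (Suc n) g \<longleftrightarrow>
      (\<forall>c. \<forall>v\<in>cube n. f (v(Suc n := c)) = g (v(Suc n := c)))"
    by (auto simp: Suc length_bits restrict_last_def all_bool_eq)
  also have "\<dots> \<longleftrightarrow> (\<forall>v\<in>cube (Suc n). f v = g v)"
    by (metis cube_SucE upd_cube_Suc)
  finally show ?case .
qed

lemma inj_on_bits: "inj_on (bits n) (mbf n)"
  by (rule inj_onI, rule ext) (metis bits_eq_iff mbf_undefined)

lemma horner_sum_of_bool_inj:
  assumes len: "length xs = length ys"
    and eq: "horner_sum of_bool (2::nat) xs = horner_sum of_bool 2 ys"
  shows "xs = ys"
proof (rule nth_equalityI[OF len])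
  fix i assume "i < length xs"
  then show "xs ! i = ys ! i"
    using arg_cong[OF eq, of "\<lambda>m. bit m i"] len
    by (simp only: bit_horner_sum_bit_iff possible_bit_nat simp_thms)
qed

lemma inj_on_bits_value: "inj_on (bits_value n) (mbf n)"
proof (rule inj_onI)
  fix f g assume *: "f \<in> mbf n" "g \<in> mbf n" "bits_value n f = bits_value n g"
  then have "rev (bits n f) = rev (bits n g)"
    unfolding bits_value_def by (intro horner_sum_of_bool_inj) (simp_all add: length_bits)
  then show "f = g" using inj_on_bits * by (auto dest: inj_onD)
qed

lemma bits_dual: "bits n (dual n x) = map Not (rev (bits n x))"
proof (induction n arbitrary: x)
  case 0
  have "neg_point 0 (\<lambda>i. undefined) = (\<lambda>i. undefined)"
    by (simp add: neg_point_def fun_eq_iff)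
  then show ?case by (simp add: dual_def cube_0)
next
  case (Suc n)
  have *: "(neg_point n v)(Suc n := c) = neg_point (Suc n) (v(Suc n := \<not> c))" for v c
    by (auto simp: neg_point_def fun_eq_iff restrict_def)
  have "restrict_last n c (dual (Suc n) x) = dual n (restrict_last n (\<not> c) x)" for c
    using upd_cube_Suc by (auto simp: restrict_last_def dual_def neg_point_cube * fun_eq_iff)
  then show ?case by (simp add: Suc)
qed

end

theory Submission imports Defs begin

text \<open>
  Cutting a string in half twice is the whole idea. Write \<open>f \<cdot> g\<close> for concatenation; the functions in
  \<open>mbf (Suc m)\<close> are exactly the \<open>f \<cdot> g\<close> with \<open>f \<le> g\<close> in \<open>mbf m\<close>, and reversing and negating a
  concatenation gives \<open>(f \<cdot> g)\<^sup>* = g\<^sup>* \<cdot> f\<^sup>*\<close>.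

  A self-dual \<open>f \<cdot> g\<close> is therefore determined by its left half: it has the form \<open>f \<cdot> f\<^sup>*\<close>, and the only
  condition left on \<open>f\<close> is \<open>f \<le> f\<^sup>*\<close> (\<open>self_dual_count_Suc\<close>). When \<open>f\<close> has at least one variable, cut
  it once more, and name its halves so that \<open>f = d\<^sup>* \<cdot> b\<close>. Then \<open>f\<^sup>* = b\<^sup>* \<cdot> d\<close>. Monotonicity of \<open>f\<close>
  says \<open>d\<^sup>* \<le> b\<close>, and \<open>f \<le> f\<^sup>*\<close> says \<open>d\<^sup>* \<le> b\<^sup>*\<close> and \<open>b \<le> d\<close>. As duality reverses the order, these
  three inequalities amount to \<open>b \<le> d\<close> and \<open>b\<^sup>* \<le> d\<close>, which is \<open>b | b\<^sup>* \<le> d\<close>. The pairs \<open>(b, d)\<close>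
  with this property are thus in bijection with the self-dual functions of two more variables, and
  counting them by the first component gives the sum over \<open>mbf n\<close>.

  For the sum over classes, a permutation of the variables is an automorphism of the ordered set
  \<open>mbf n\<close> that commutes with duality. So \<open>re (b | b\<^sup>*) \<top>\<close> is constant on each class, and the class
  of \<open>b\<close> contributes this value as often as it has elements.
\<close>

section \<open>Order and duality\<close>

lemma mbf_mono: "g \<in> mbf n \<Longrightarrow> v \<in> cube n \<Longrightarrow> w \<in> cube n \<Longrightarrow> v \<le> w \<Longrightarrow> g v \<le> g w"
  by (auto simp: mbf_def dest: mono_onD)

lemma neg_point_neg_point: "v \<in> cube n \<Longrightarrow> neg_point n (neg_point n v) = v"
  by (auto simp: neg_point_def fun_eq_iff cube_undefined)

lemma dual_dual: "x \<in> mbf n \<Longrightarrow> dual n (dual n x) = x"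
  by (auto simp: dual_def fun_eq_iff neg_point_cube neg_point_neg_point mbf_undefined)

lemma dual_antimono: "f \<le> g \<Longrightarrow> dual n g \<le> dual n f"
  by (auto simp: dual_def le_fun_def)

lemma dual_le_iff: "f \<in> mbf n \<Longrightarrow> g \<in> mbf n \<Longrightarrow> dual n f \<le> g \<longleftrightarrow> dual n g \<le> f"
  using dual_antimono[of "dual n f" g n] dual_antimono[of "dual n g" f n] by (auto simp: dual_dual)

lemma dual_le_dual_iff: "f \<in> mbf n \<Longrightarrow> g \<in> mbf n \<Longrightarrow> dual n f \<le> dual n g \<longleftrightarrow> g \<le> f"
  using dual_le_iff[of f n "dual n g"] by (simp add: dual_mbf dual_dual)

lemma dual_eq_iff: "f \<in> mbf n \<Longrightarrow> g \<in> mbf n \<Longrightarrow> dual n f = dual n g \<longleftrightarrow> f = g"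
  by (auto simp: order.eq_iff[of f] order.eq_iff[of "dual n f"] dual_le_dual_iff)

section \<open>Concatenation of strings\<close>

text \<open>The argument of a half is a point of \<open>cube n\<close>, which is \<open>undefined\<close> at \<open>Suc n\<close>; this is why that
  coordinate is overwritten once it has selected the half.\<close>

definition concat_fun ::
  "nat \<Rightarrow> ((nat \<Rightarrow> bool) \<Rightarrow> bool) \<Rightarrow> ((nat \<Rightarrow> bool) \<Rightarrow> bool) \<Rightarrow> (nat \<Rightarrow> bool) \<Rightarrow> bool" where
  "concat_fun n f g =
     (\<lambda>v\<in>cube (Suc n). (if v (Suc n) then g else f) (v(Suc n := undefined)))"

lemma drop_last_cube: "v \<in> cube (Suc n) \<Longrightarrow> v(Suc n := undefined) \<in> cube n"
  by (auto simp: cube_def PiE_def extensional_def)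

lemma concat_fun_upd:
  assumes "v \<in> cube n"
  shows "concat_fun n f g (v(Suc n := c)) = (if c then g v else f v)"
proof -
  have "v(Suc n := undefined) = v"
    using assms by (auto simp: fun_eq_iff cube_undefined)
  then show ?thesis using upd_cube_Suc[OF assms, of c] by (simp add: concat_fun_def)
qed

lemma ball_cube_Suc: "(\<forall>v\<in>cube (Suc n). P v) \<longleftrightarrow> (\<forall>v\<in>cube n. \<forall>c. P (v(Suc n := c)))"
  by (metis cube_SucE upd_cube_Suc)

text \<open>Raising one of the first \<open>n\<close> coordinates stays within a half, where \<open>f\<close> or \<open>g\<close> is monotone;
  raising the last one moves from \<open>f\<close> to \<open>g\<close>.\<close>

lemma concat_fun_mbf:
  assumes "f \<in> mbf n" "g \<in> mbf n" "f \<le> g"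
  shows "concat_fun n f g \<in> mbf (Suc n)"
proof -
  have "concat_fun n f g v \<le> concat_fun n f g w"
    if vw: "v \<in> cube (Suc n)" "w \<in> cube (Suc n)" "v \<le> w" for v w
  proof -
    let ?v = "v(Suc n := undefined)" and ?w = "w(Suc n := undefined)"
    have c: "?v \<in> cube n" "?w \<in> cube n" using vw drop_last_cube by auto
    have le: "?v \<le> ?w" "v (Suc n) \<le> w (Suc n)" using vw(3) by (auto simp: le_fun_def)
    have "f ?v \<le> f ?w" "g ?v \<le> g ?w"
      using assms c le(1) by (auto dest: mbf_mono)
    moreover have "f ?v \<le> g ?v" using assms(3) by (simp add: le_fun_def)
    ultimately show ?thesis using vw(1,2) le(2) by (auto simp: concat_fun_def)
  qed
  then have "mono_on (cube (Suc n)) (concat_fun n f g)" by (rule mono_onI)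
  then show ?thesis by (simp add: mbf_def concat_fun_def)
qed

lemma restrict_last_mbf:
  assumes "g \<in> mbf (Suc n)"
  shows "restrict_last n c g \<in> mbf n"
proof -
  have "v(Suc n := c) \<le> w(Suc n := c)" if "v \<le> w" for v w :: "nat \<Rightarrow> bool"
    using that by (auto simp: le_fun_def)
  then have "restrict_last n c g v \<le> restrict_last n c g w"
    if "v \<in> cube n" "w \<in> cube n" "v \<le> w" for v w
    using that mbf_mono[OF assms upd_cube_Suc upd_cube_Suc, of v w c c]
    by (simp add: restrict_last_def)
  then have "mono_on (cube n) (restrict_last n c g)" by (rule mono_onI)
  then show ?thesis by (simp add: mbf_def restrict_last_def)
qed

lemma restrict_last_le:
  assumes "g \<in> mbf (Suc n)"
  shows "restrict_last n False g \<le> restrict_last n True g"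
proof -
  have "v(Suc n := False) \<le> v(Suc n := True)" for v :: "nat \<Rightarrow> bool"
    by (auto simp: le_fun_def)
  then have "g (v(Suc n := False)) \<le> g (v(Suc n := True))" if "v \<in> cube n" for v
    using mbf_mono[OF assms] upd_cube_Suc[OF that] by blast
  then show ?thesis by (auto simp: le_fun_def restrict_last_def)
qed

lemma restrict_last_concat_fun:
  assumes "f \<in> mbf n" "g \<in> mbf n"
  shows "restrict_last n c (concat_fun n f g) = (if c then g else f)"
  using assms by (auto simp: restrict_last_def concat_fun_upd fun_eq_iff mbf_undefined)

lemma concat_fun_restrict_last:
  assumes "g \<in> mbf (Suc n)"
  shows "concat_fun n (restrict_last n False g) (restrict_last n True g) = g"
proof
  fix v
  have "\<forall>v\<in>cube (Suc n). concat_fun n (restrict_last n False g) (restrict_last n True g) v = g v"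
    by (simp add: ball_cube_Suc concat_fun_upd restrict_last_def)
  moreover have "concat_fun n f h v = g v" if "v \<notin> cube (Suc n)" for f h
    using that assms by (simp add: concat_fun_def mbf_undefined)
  ultimately show "concat_fun n (restrict_last n False g) (restrict_last n True g) v = g v"
    by blast
qed

lemma mbf_SucE:
  assumes "x \<in> mbf (Suc n)"
  obtains f g where "f \<in> mbf n" "g \<in> mbf n" "f \<le> g" "x = concat_fun n f g"
  using assms restrict_last_mbf restrict_last_le concat_fun_restrict_last by metis

lemma concat_fun_le_iff:
  assumes "f \<in> mbf n" "g \<in> mbf n" "f' \<in> mbf n" "g' \<in> mbf n"
  shows "concat_fun n f g \<le> concat_fun n f' g' \<longleftrightarrow> f \<le> f' \<and> g \<le> g'"
proof -
  have "concat_fun n f g v \<le> concat_fun n f' g' v" if "v \<notin> cube (Suc n)" for v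
    using that by (simp add: concat_fun_def)
  then have "concat_fun n f g \<le> concat_fun n f' g' \<longleftrightarrow>
      (\<forall>v\<in>cube (Suc n). concat_fun n f g v \<le> concat_fun n f' g' v)"
    unfolding le_fun_def by blast
  also have "\<dots> \<longleftrightarrow> f \<le> f' \<and> g \<le> g'"
    using assms by (auto simp: ball_cube_Suc concat_fun_upd mbf_le_iff all_bool_eq)
  finally show ?thesis .
qed

lemma concat_fun_eq_iff:
  assumes "f \<in> mbf n" "g \<in> mbf n" "f' \<in> mbf n" "g' \<in> mbf n"
  shows "concat_fun n f g = concat_fun n f' g' \<longleftrightarrow> f = f' \<and> g = g'"
  using assms
  by (auto simp: order.eq_iff[of "concat_fun n f g"] order.eq_iff[of f] order.eq_iff[of g]
      concat_fun_le_iff)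

text \<open>Reversing the string swaps the two halves besides reversing each of them.\<close>

lemma dual_concat_fun: "dual (Suc n) (concat_fun n f g) = concat_fun n (dual n g) (dual n f)"
proof
  fix v
  have neg: "neg_point (Suc n) (v(Suc n := c)) = (neg_point n v)(Suc n := \<not> c)" for v c
    by (auto simp: neg_point_def fun_eq_iff restrict_def)
  have "\<forall>v\<in>cube (Suc n).
      dual (Suc n) (concat_fun n f g) v = concat_fun n (dual n g) (dual n f) v"
    unfolding ball_cube_Suc
    by (simp add: dual_def upd_cube_Suc neg concat_fun_upd neg_point_cube)
  moreover have "dual (Suc n) (concat_fun n f g) v = concat_fun n (dual n g) (dual n f) v"
    if "v \<notin> cube (Suc n)"
    using that by (simp add: dual_def concat_fun_def)
  ultimately show "dual (Suc n) (concat_fun n f g) v = concat_fun n (dual n g) (dual n f) v"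
    by blast
qed

section \<open>Counting self-dual functions\<close>

text \<open>By \<open>dual_concat_fun\<close>, a concatenation is self-dual iff its right half is the dual of its left
  half; being monotone, it then has a left half below its own dual.\<close>

lemma self_dual_count_Suc: "self_dual_count (Suc n) = card {f \<in> mbf n. f \<le> dual n f}"
proof -
  have "bij_betw (\<lambda>f. concat_fun n f (dual n f)) {f \<in> mbf n. f \<le> dual n f}
      {x \<in> mbf (Suc n). x = dual (Suc n) x}"
  proof (rule bij_betw_imageI)
    show "inj_on (\<lambda>f. concat_fun n f (dual n f)) {f \<in> mbf n. f \<le> dual n f}"
      by (rule inj_onI) (auto simp: concat_fun_eq_iff dual_mbf)
    have "x \<in> (\<lambda>f. concat_fun n f (dual n f)) ` {f \<in> mbf n. f \<le> dual n f}"
      if x: "x \<in> mbf (Suc n)" "x = dual (Suc n) x" for x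
    proof -
      obtain f g where fg: "f \<in> mbf n" "g \<in> mbf n" "f \<le> g" "x = concat_fun n f g"
        using x(1) by (rule mbf_SucE)
      have "concat_fun n f g = concat_fun n (dual n g) (dual n f)"
        using x(2) unfolding fg(4) dual_concat_fun .
      then have "g = dual n f"
        using concat_fun_eq_iff[OF fg(1,2) dual_mbf[OF fg(2)] dual_mbf[OF fg(1)]] by blast
      then show ?thesis using fg by auto
    qed
    then show "(\<lambda>f. concat_fun n f (dual n f)) ` {f \<in> mbf n. f \<le> dual n f} =
        {x \<in> mbf (Suc n). x = dual (Suc n) x}"
      by (auto simp: concat_fun_mbf dual_mbf dual_concat_fun dual_dual)
  qed
  then show ?thesis by (simp add: self_dual_count_def bij_betw_same_card)
qed

text \<open>The left half is taken to be \<open>d\<^sup>*\<close> rather than \<open>d\<close>: then all the conditions on the two halves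
  can be turned, by dualizing, into lower bounds on \<open>d\<close>.\<close>

lemma card_le_dual_Suc:
  "card {f \<in> mbf (Suc n). f \<le> dual (Suc n) f} =
   card {(b, d). b \<in> mbf n \<and> d \<in> mbf n \<and> sup b (dual n b) \<le> d}" (is "card ?F = card ?P")
proof -
  let ?h = "\<lambda>(b, d). concat_fun n (dual n d) b"
  have cond: "dual n d \<le> b \<and> concat_fun n (dual n d) b \<le> dual (Suc n) (concat_fun n (dual n d) b)
      \<longleftrightarrow> sup b (dual n b) \<le> d" if "b \<in> mbf n" "d \<in> mbf n" for b d
    using that dual_le_iff[of b n d]
    by (auto simp: dual_concat_fun concat_fun_le_iff dual_mbf dual_dual dual_le_dual_iff)
  have "bij_betw ?h ?P ?F"
  proof (rule bij_betw_imageI)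
    show "inj_on ?h ?P"
      by (rule inj_onI) (auto simp: concat_fun_eq_iff dual_mbf dual_eq_iff)
    show "?h ` ?P = ?F"
    proof (intro equalityI subsetI)
      fix x assume "x \<in> ?h ` ?P"
      then show "x \<in> ?F" using cond by (auto intro!: concat_fun_mbf dual_mbf)
    next
      fix x assume x: "x \<in> ?F"
      then obtain a b where ab: "a \<in> mbf n" "b \<in> mbf n" "a \<le> b" "x = concat_fun n a b"
        by (auto elim: mbf_SucE)
      let ?d = "dual n a"
      have "(b, ?d) \<in> ?P" "x = ?h (b, ?d)"
        using ab x cond[of b ?d] by (auto simp: dual_dual dual_mbf)
      then show "x \<in> ?h ` ?P" by (rule rev_image_eqI)
    qed
  qed
  then show ?thesis by (simp add: bij_betw_same_card)
qed

lemma self_dual_count_pairs: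
  "self_dual_count (n + 2) =
     card {(b, d). b \<in> mbf n \<and> d \<in> mbf n \<and> sup b (dual n b) \<le> d}"
  by (simp add: self_dual_count_Suc card_le_dual_Suc)

lemma le_mbf_top: "z \<in> mbf n \<Longrightarrow> z \<le> mbf_top n"
  by (simp add: mbf_le_iff mbf_top) (simp add: mbf_top_def)

lemma card_pairs_eq_sum_re:
  "card {(b, d). b \<in> mbf n \<and> d \<in> mbf n \<and> \<phi> b \<le> d} = (\<Sum>b\<in>mbf n. re n (\<phi> b) (mbf_top n))"
proof -
  have "{(b, d). b \<in> mbf n \<and> d \<in> mbf n \<and> \<phi> b \<le> d} =
      (SIGMA b:mbf n. {z \<in> mbf n. \<phi> b \<le> z \<and> z \<le> mbf_top n})"
    using le_mbf_top by blast
  then show ?thesis by (simp add: card_SigmaI finite_mbf re_def)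
qed

section \<open>Permuting the variables\<close>

lemma perm_fun_dual:
  assumes p: "p permutes {1..n}"
  shows "perm_fun p (dual n g) = dual n (perm_fun p g)"
proof
  fix v
  have "inv p i \<in> {1..n} \<longleftrightarrow> i \<in> {1..n}" for i
    by (rule permutes_in_image[OF permutes_inv[OF p]])
  then have "neg_point n (perm_point p v) = perm_point p (neg_point n v)"
    unfolding neg_point_def perm_point_def restrict_def comp_def by simp
  then show "perm_fun p (dual n g) v = dual n (perm_fun p g) v"
    by (simp add: perm_fun_def dual_def perm_point_cube[OF p])
qed

lemma perm_fun_sup: "perm_fun p (sup f g) = sup (perm_fun p f) (perm_fun p g)"
  by (simp add: perm_fun_def fun_eq_iff)

lemma perm_fun_mbf_top: "p permutes {1..n} \<Longrightarrow> perm_fun p (mbf_top n) = mbf_top n"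
  by (simp add: perm_fun_def mbf_top_def fun_eq_iff perm_point_cube restrict_def)

lemma perm_fun_mono: "f \<le> g \<Longrightarrow> perm_fun p f \<le> perm_fun p g"
  by (simp add: perm_fun_def le_fun_def)

lemma perm_fun_inv:
  assumes p: "p permutes {1..n}"
  shows "perm_fun (inv p) (perm_fun p g) = g" "perm_fun p (perm_fun (inv p) g) = g"
  unfolding perm_fun_def perm_point_def fun_eq_iff
  by (simp_all add: o_assoc[symmetric] inv_inv_eq[OF permutes_bij[OF p]]
      permutes_inv_o[OF p])

text \<open>An order automorphism maps the interval from \<open>x\<close> to \<open>y\<close> bijectively onto the interval between
  their images.\<close>

lemma re_perm_fun:
  assumes p: "p permutes {1..n}"
  shows "re n (perm_fun p x) (perm_fun p y) = re n x y"
proof -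
  note inv = perm_fun_inv[OF p]
  note p' = permutes_inv[OF p]
  have lower: "x \<le> perm_fun (inv p) z" if "perm_fun p x \<le> z" for z
    using perm_fun_mono[OF that, of "inv p"] by (simp only: inv)
  have upper: "perm_fun (inv p) z \<le> y" if "z \<le> perm_fun p y" for z
    using perm_fun_mono[OF that, of "inv p"] by (simp only: inv)
  have "bij_betw (perm_fun p) {z \<in> mbf n. x \<le> z \<and> z \<le> y}
      {z \<in> mbf n. perm_fun p x \<le> z \<and> z \<le> perm_fun p y}"
  proof (rule bij_betw_byWitness[where f' = "perm_fun (inv p)"])
    show "perm_fun p ` {z \<in> mbf n. x \<le> z \<and> z \<le> y}
        \<subseteq> {z \<in> mbf n. perm_fun p x \<le> z \<and> z \<le> perm_fun p y}"
      using perm_fun_mbf[OF p] perm_fun_mono by blast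
    show "perm_fun (inv p) ` {z \<in> mbf n. perm_fun p x \<le> z \<and> z \<le> perm_fun p y}
        \<subseteq> {z \<in> mbf n. x \<le> z \<and> z \<le> y}"
      using perm_fun_mbf[OF p'] lower upper by blast
  qed (simp_all only: inv ball_simps simp_thms)
  then show ?thesis by (simp add: re_def bij_betw_same_card)
qed

lemma re_sup_dual_equiv:
  assumes "(f, g) \<in> mbf_equiv n"
  shows "re n (sup f (dual n f)) (mbf_top n) = re n (sup g (dual n g)) (mbf_top n)"
proof -
  obtain p where p: "p permutes {1..n}" and f: "f = perm_fun p g"
    using assms by (auto simp: mbf_equiv_def)
  then show ?thesis
    using re_perm_fun[OF p, of "sup g (dual n g)" "mbf_top n"]
    by (simp add: perm_fun_sup perm_fun_dual perm_fun_mbf_top)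
qed

lemma representative_in_class:
  assumes "C \<in> mbf_classes n"
  shows "representative n C \<in> C"
proof -
  have "C \<noteq> {}" "C \<subseteq> mbf n"
    using assms in_quotient_imp_non_empty[OF equiv_mbf_equiv]
      in_quotient_imp_subset[OF equiv_mbf_equiv] by (auto simp: mbf_classes_def)
  then show ?thesis
    by (simp add: representative_def arg_min_if_finite finite_subset[OF _ finite_mbf])
qed

text \<open>Any class member would do in place of the representative, since the summand is constant on
  the class.\<close>

lemma sum_mbf_by_classes:
  assumes invariant: "\<And>f g. (f, g) \<in> mbf_equiv n \<Longrightarrow> \<phi> f = \<phi> g"
  shows "(\<Sum>b\<in>mbf n. \<phi> b :: nat) =
    (\<Sum>C\<in>mbf_classes n. class_size n (representative n C) * \<phi> (representative n C))"
proof -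
  note eq = equiv_mbf_equiv[of n]
  have "(\<Sum>b\<in>mbf n. \<phi> b) = (\<Sum>b\<in>\<Union>(mbf_classes n). \<phi> b)"
    by (simp add: mbf_classes_def Union_quotient[OF eq])
  also have "\<dots> = (\<Sum>C\<in>mbf_classes n. \<Sum>b\<in>C. \<phi> b)"
    by (subst sum.Union_disjoint)
      (auto simp: mbf_classes_def dest: quotient_disj[OF eq]
        intro: finite_subset[OF in_quotient_imp_subset[OF eq] finite_mbf])
  also have "\<dots> =
      (\<Sum>C\<in>mbf_classes n. class_size n (representative n C) * \<phi> (representative n C))"
  proof (rule sum.cong[OF refl])
    fix C assume C: "C \<in> mbf_classes n"
    let ?r = "representative n C"
    have r: "?r \<in> C" using C by (rule representative_in_class)
    obtain a where "C = mbf_equiv n `` {a}"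
      using C by (auto simp: mbf_classes_def elim: quotientE)
    then have class_r: "C = mbf_equiv n `` {?r}"
      using r equiv_class_eq[OF eq] by blast
    then have "\<phi> b = \<phi> ?r" if "b \<in> C" for b
      using invariant[of ?r b] that Image_singleton_iff[of b "mbf_equiv n" ?r] by metis
    then have "(\<Sum>b\<in>C. \<phi> b) = card C * \<phi> ?r" by simp
    also have "card C = class_size n ?r"
      using class_r by (simp add: class_size_def)
    finally show "(\<Sum>b\<in>C. \<phi> b) = class_size n ?r * \<phi> ?r" .
  qed
  finally show ?thesis .
qed

section \<open>The number of self-dual functions of two more variables\<close>

theorem lemma4:
  fixes n :: nat
  shows "self_dual_count (n + 2) =
           card {(b, d). b \<in> mbf n \<and> d \<in> mbf n \<and> sup b (dual n b) \<le> d}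
       \<and> self_dual_count (n + 2) =
           (\<Sum>b\<in>mbf n. re n (sup b (dual n b)) (mbf_top n))
       \<and> self_dual_count (n + 2) =
           (\<Sum>C\<in>mbf_classes n.
              let b = representative n C
              in class_size n b * re n (sup b (dual n b)) (mbf_top n))"
proof -
  let ?\<phi> = "\<lambda>b. re n (sup b (dual n b)) (mbf_top n)"
  have "self_dual_count (n + 2) = (\<Sum>b\<in>mbf n. ?\<phi> b)"
    by (simp only: self_dual_count_pairs card_pairs_eq_sum_re)
  moreover have "(\<Sum>b\<in>mbf n. ?\<phi> b) =
      (\<Sum>C\<in>mbf_classes n. class_size n (representative n C) * ?\<phi> (representative n C))"
    by (rule sum_mbf_by_classes) (rule re_sup_dual_equiv)
  ultimately show ?thesis
    unfolding Let_def by (simp only: self_dual_count_pairs[symmetric])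
qed

end
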